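(* Every loopless matroid $M$ satisfies $\chi_i(M)=\chi(M)$.
   Context: Let $M$ be a loopless matroid on a finite ground set $E$. A coloring of $E$ is proper if the elements of each color class form an independent set of $M$. The chromatic number $\chi(M)$ is the minimum number of colors needed to color $E$ properly. The indicated coloring game on $M$ with a fixed finite color set $C$: in each round Alice indicates an element of $E$ not yet colored, and Bob colors it with a color from $C$ so that the coloring remains proper. The game ends when all of $E$ is colored (Alice wins) or when Bob cannot color the indicated element with any color of $C$ keeping the coloring proper (Bob wins). The indicated chromatic number $\chi_i(M)$ is the minimum $|C|$ for which Alice has a winning strategy. *)

theory Defs
  imports Main
begin

locale matroid =
  fixes E :: "'a set" and indep :: "'a set \<Rightarrow> bool"
  assumes finite_ground: "finite E"
    and indep_subset_ground: "indep X \<Longrightarrow> X \<subseteq> E"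
    and indep_empty: "indep {}"
    and indep_mono: "indep Y \<Longrightarrow> X \<subseteq> Y \<Longrightarrow> indep X"
    and augmentation:
      "indep X \<Longrightarrow> indep Y \<Longrightarrow> card X < card Y \<Longrightarrow> \<exists>e\<in>Y - X. indep (insert e X)"

locale loopless_matroid = matroid +
  assumes loopless: "e \<in> E \<Longrightarrow> indep {e}"

text \<open>A (partial) coloring is a map; its domain is the set of colored elements.\<close>

definition proper :: "('a set \<Rightarrow> bool) \<Rightarrow> ('a \<rightharpoonup> 'c) \<Rightarrow> bool" where
  "proper indep f \<longleftrightarrow> (\<forall>c. indep {e. f e = Some c})"

definition properly_colorable :: "'a set \<Rightarrow> ('a set \<Rightarrow> bool) \<Rightarrow> 'c set \<Rightarrow> bool" where
  "properly_colorable E indep C \<longleftrightarrow> (\<exists>f. dom f = E \<and> ran f \<subseteq> C \<and> proper indep f)"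

definition chromatic_number :: "'a set \<Rightarrow> ('a set \<Rightarrow> bool) \<Rightarrow> nat" where
  "chromatic_number E indep =
    (LEAST k. \<exists>C :: nat set. finite C \<and> card C = k \<and> properly_colorable E indep C)"

text \<open>
  The indicated coloring game. A history is the list of rounds played so far, latest first,
  each given by the indicated element and the color it received; \<^term>\<open>map_of h\<close> is the
  current partial coloring. A strategy of Alice maps every history to the next element to
  indicate. The set \<open>plays E indep C s\<close> consists of the histories that can arise when Alice
  follows \<open>s\<close> and Bob makes arbitrary admissible choices from \<open>C\<close>.
\<close>

inductive_set plays ::
  "'a set \<Rightarrow> ('a set \<Rightarrow> bool) \<Rightarrow> 'c set \<Rightarrow> (('a \<times> 'c) list \<Rightarrow> 'a) \<Rightarrow> ('a \<times> 'c) list set"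
  for E indep C s where
  start: "[] \<in> plays E indep C s"
| round: "h \<in> plays E indep C s \<Longrightarrow> s h \<in> E - dom (map_of h) \<Longrightarrow> c \<in> C \<Longrightarrow>
    proper indep ((map_of h)(s h \<mapsto> c)) \<Longrightarrow> (s h, c) # h \<in> plays E indep C s"

text \<open>
  Every round colors a new element, so on a finite ground set every play ends, and Alice wins
  it iff Bob never gets stuck before all of \<open>E\<close> is colored.
\<close>

definition winning_strategy ::
  "'a set \<Rightarrow> ('a set \<Rightarrow> bool) \<Rightarrow> 'c set \<Rightarrow> (('a \<times> 'c) list \<Rightarrow> 'a) \<Rightarrow> bool" where
  "winning_strategy E indep C s \<longleftrightarrow>
    (\<forall>h\<in>plays E indep C s. dom (map_of h) \<noteq> E \<longrightarrow>
       s h \<in> E - dom (map_of h) \<and> (\<exists>c\<in>C. proper indep ((map_of h)(s h \<mapsto> c))))"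

definition indicated_chromatic_number :: "'a set \<Rightarrow> ('a set \<Rightarrow> bool) \<Rightarrow> nat" where
  "indicated_chromatic_number E indep =
    (LEAST k. \<exists>C :: nat set. finite C \<and> card C = k \<and> (\<exists>s. winning_strategy E indep C s))"

text \<open>
  For loopless matroids neither minimum is taken over an empty set: \<open>card E\<close> colors suffice.
\<close>

lemma (in loopless_matroid) properly_colorable_card_ground:
  "properly_colorable E indep {..<card E}"
proof -
  obtain g where g: "bij_betw g E {0..<card E}"
    using ex_bij_betw_finite_nat[OF finite_ground] by blast
  define f where "f = (\<lambda>e. if e \<in> E then Some (g e) else None)"
  have "dom f = E" by (auto simp: f_def split: if_splits)
  moreover have "ran f \<subseteq> {..<card E}"
    using bij_betwE[OF g] by (auto simp: f_def ran_def split: if_splits)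
  moreover have "indep {e. f e = Some c}" for c
  proof (cases "\<exists>e\<in>E. g e = c")
    case True
    then obtain e where e: "e \<in> E" "g e = c" by blast
    have "{e. f e = Some c} \<subseteq> {e}"
      using bij_betw_imp_inj_on[OF g] e by (auto simp: f_def inj_on_def split: if_splits)
    then show ?thesis using loopless[OF e(1)] indep_mono by blast
  next
    case False
    then have "{e. f e = Some c} = {}" by (auto simp: f_def split: if_splits)
    then show ?thesis using indep_empty by simp
  qed
  ultimately show ?thesis unfolding properly_colorable_def proper_def by blast
qed

lemma (in loopless_matroid) ex_winning_strategy_card_ground:
  "\<exists>s. winning_strategy E indep {..<card E} s"
proof -
  define s :: "('a \<times> nat) list \<Rightarrow> 'a" where "s h = (SOME e. e \<in> E - dom (map_of h))" for h
  have inv: "dom (map_of h) \<subseteq> E \<and> proper indep (map_of h)"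
    if "h \<in> plays E indep {..<card E} s" for h
    using that
  proof induction
    case start
    then show ?case by (simp add: proper_def indep_empty)
  next
    case (round h c)
    have "map_of ((s h, c) # h) = (map_of h)(s h \<mapsto> c)" by (simp add: fun_eq_iff)
    moreover have "dom ((map_of h)(s h \<mapsto> c)) \<subseteq> E" using round by simp
    ultimately show ?case using round(4) by (simp only: simp_thms)
  qed
  have "s h \<in> E - dom (map_of h) \<and> (\<exists>c\<in>{..<card E}. proper indep ((map_of h)(s h \<mapsto> c)))"
    if h: "h \<in> plays E indep {..<card E} s" and ne: "dom (map_of h) \<noteq> E" for h
  proof -
    have sub: "dom (map_of h) \<subset> E" using inv[OF h] ne by blast
    then have "\<exists>e. e \<in> E - dom (map_of h)" by blast
    then have s: "s h \<in> E - dom (map_of h)" unfolding s_def by (rule someI_ex)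
    have fin: "finite (dom (map_of h))" by (rule finite_dom_map_of)
    have ran: "ran (map_of h) = (\<lambda>e. the (map_of h e)) ` dom (map_of h)"
      by (force simp: ran_def dom_def image_iff)
    have "card (ran (map_of h)) \<le> card (dom (map_of h))"
      unfolding ran using fin by (rule card_image_le)
    also have "\<dots> < card {..<card E}"
      using psubset_card_mono[OF finite_ground sub] by simp
    finally have "\<not> {..<card E} \<subseteq> ran (map_of h)"
      using card_mono[of "ran (map_of h)" "{..<card E}"] fin ran by fastforce
    then obtain c where c: "c \<in> {..<card E}" "c \<notin> ran (map_of h)" by blast
    have "indep {e. ((map_of h)(s h \<mapsto> c)) e = Some d}" for d
    proof (cases "d = c")
      case True
      then have "{e. ((map_of h)(s h \<mapsto> c)) e = Some d} = {s h}"
        using c(2) by (auto simp: ran_def)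
      then show ?thesis using loopless s by simp
    next
      case False
      then have "{e. ((map_of h)(s h \<mapsto> c)) e = Some d} \<subseteq> {e. map_of h e = Some d}"
        by auto
      then show ?thesis using inv[OF h] indep_mono unfolding proper_def by blast
    qed
    then show ?thesis using s c(1) unfolding proper_def by blast
  qed
  then show ?thesis unfolding winning_strategy_def by blast
qed

end

theory Submission
  imports Defs
begin

text \<open>
  Let \<open>r\<close> be the rank function and \<open>F\<^sub>c\<close> the set of elements colored \<open>c\<close> so far. Alice maintains
  the Hall-type condition \<open>|S| \<le> (\<Sum>c. r (S \<union> F\<^sub>c) - |F\<^sub>c|)\<close> for all sets \<open>S\<close> of uncolored
  elements. It holds initially if \<open>M\<close> is properly colorable, and for singletons \<open>S\<close> it says that
  Bob is not stuck. The right-hand side is submodular in \<open>S\<close>, so tight sets are closed under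
  unions and intersections. Alice indicates any element \<open>e\<close> of an inclusion-minimal nonempty
  tight set \<open>T\<close> (any element at all if there is none). If Bob colors \<open>e\<close> with \<open>c\<close>, the condition
  can only fail at a tight \<open>S\<close> not containing \<open>e\<close>; such an \<open>S\<close> is disjoint from \<open>T\<close>, and tightness
  of \<open>S \<union> T\<close> means that every summand is additive over \<open>S\<close> and \<open>T\<close>, which gives the slack needed.
\<close>

section \<open>Tight sets of a family of submodular set functions\<close>

text \<open>Meant for \<open>g c\<close> the residual rank of color \<open>c\<close> and
  \<open>U\<close> the uncolored elements. Then \<open>1 \<le> g c {e}\<close> says that
  \<open>c\<close> is admissible for \<open>e\<close>, and the \<open>+ 1\<close> pays for the unit
  lost when \<open>e\<close> joins the color class of \<open>c\<close>.\<close>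

lemma submodular_family_ex_safe_element:
  fixes g :: "'c \<Rightarrow> 'a set \<Rightarrow> int"
  assumes U: "finite U" "U \<noteq> {}" and C: "finite C"
    and empty: "\<And>c. c \<in> C \<Longrightarrow> g c {} = 0"
    and mono: "\<And>c A B. c \<in> C \<Longrightarrow> A \<subseteq> B \<Longrightarrow> B \<subseteq> U \<Longrightarrow> g c A \<le> g c B"
    and submod: "\<And>c A B. c \<in> C \<Longrightarrow> A \<subseteq> U \<Longrightarrow> B \<subseteq> U \<Longrightarrow>
      g c (A \<union> B) + g c (A \<inter> B) \<le> g c A + g c B"
    and hall: "\<And>S. S \<subseteq> U \<Longrightarrow> int (card S) \<le> (\<Sum>c\<in>C. g c S)"
  shows "\<exists>e\<in>U. \<forall>c\<in>C. 1 \<le> g c {e} \<longrightarrow>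
    (\<forall>S. S \<subseteq> U - {e} \<longrightarrow>
      int (card S) + 1 \<le> (\<Sum>d\<in>C. if d = c then g d (insert e S) else g d S))"
proof -
  define tight where "tight S \<longleftrightarrow> S \<subseteq> U \<and> (\<Sum>c\<in>C. g c S) = int (card S)" for S
  \<comment> \<open>A set that is not tight has a spare unit by integrality, and monotonicity then
    suffices; only tight sets call for a careful choice of \<open>e\<close>.\<close>
  have "\<exists>e\<in>U. \<forall>c\<in>C. \<forall>S. tight S \<longrightarrow> e \<notin> S \<longrightarrow> g c S + g c {e} \<le> g c (insert e S)"
  proof (cases "\<exists>T. T \<noteq> {} \<and> tight T")
    case True
    have "finite {T. T \<noteq> {} \<and> tight T}"
      using U(1) by (rule finite_subset[rotated, OF finite_Pow_iff[THEN iffD2]]) (auto simp: tight_def)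
    then obtain T where T: "T \<noteq> {}" "tight T"
      and minimal: "\<And>T'. T' \<noteq> {} \<Longrightarrow> tight T' \<Longrightarrow> T' \<subseteq> T \<Longrightarrow> T' = T"
      using finite_has_minimal[of "{T. T \<noteq> {} \<and> tight T}"] True by auto
    obtain e where e: "e \<in> T" using T(1) by blast
    have TU: "T \<subseteq> U" using T(2) by (simp add: tight_def)
    have "g c S + g c {e} \<le> g c (insert e S)" if c: "c \<in> C" and S: "tight S" "e \<notin> S" for c S
    proof -
      have SU: "S \<subseteq> U" using S by (simp add: tight_def)
      have fin: "finite S" "finite T" using SU TU U(1) finite_subset by auto
      have cards: "card (S \<union> T) + card (S \<inter> T) = card S + card T"
        using card_Un_Int[OF fin] by simp
      have le: "(\<Sum>c\<in>C. g c (S \<union> T)) + (\<Sum>c\<in>C. g c (S \<inter> T))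
          \<le> (\<Sum>c\<in>C. g c S) + (\<Sum>c\<in>C. g c T)"
        unfolding sum.distrib[symmetric] by (intro sum_mono submod SU TU)
      have "int (card (S \<union> T)) \<le> (\<Sum>c\<in>C. g c (S \<union> T))"
        and "int (card (S \<inter> T)) \<le> (\<Sum>c\<in>C. g c (S \<inter> T))"
        using SU TU by (auto intro!: hall)
      \<comment> \<open>The two Hall bounds add up to exactly the upper bound that
        \<open>le\<close>, \<open>cards\<close> and the tightness of \<open>S\<close> and
        \<open>T\<close> give, so both are equalities.\<close>
      with le cards S T have un: "(\<Sum>c\<in>C. g c (S \<union> T)) = int (card (S \<union> T))"
        and int: "(\<Sum>c\<in>C. g c (S \<inter> T)) = int (card (S \<inter> T))"
        unfolding tight_def by linarith+
      have "tight (S \<inter> T)" using int SU by (auto simp: tight_def)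
      \<comment> \<open>Since \<open>e\<close> lies in \<open>T\<close> but not in \<open>S\<close>,
        the intersection is a proper subset of \<open>T\<close>, and minimality leaves only the
        empty set.\<close>
      then have disj: "S \<inter> T = {}" using minimal[of "S \<inter> T"] e S(2) by blast
      have sub: "g d (S \<union> T) \<le> g d S + g d T" if "d \<in> C" for d
        using submod[OF that SU TU] empty[OF that] disj by simp
      \<comment> \<open>All summands are nonnegative by \<open>sub\<close>, so the zero sum forces
        each of them to vanish.\<close>
      have "(\<Sum>c\<in>C. g c S + g c T - g c (S \<union> T)) = 0"
        using un S T disj cards unfolding tight_def by (simp add: sum.distrib sum_subtractf)
      then have "g c S + g c T - g c (S \<union> T) = 0"
        using sum_nonneg_eq_0_iff[OF C, of "\<lambda>c. g c S + g c T - g c (S \<union> T)"] sub c by simp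
      \<comment> \<open>Here the union is \<open>S \<union> T\<close> and the intersection is
        \<open>{e}\<close>. Splitting \<open>g c (S \<union> T)\<close> additively and cancelling
        \<open>g c T\<close> leaves the claim.\<close>
      moreover have "g c (insert e S \<union> T) + g c (insert e S \<inter> T) \<le> g c (insert e S) + g c T"
        using SU TU e by (intro submod c) auto
      moreover have "insert e S \<union> T = S \<union> T" "insert e S \<inter> T = {e}" using disj e by auto
      ultimately show ?thesis by simp
    qed
    then show ?thesis using e TU by blast
  next
    case False
    obtain e where "e \<in> U" using U(2) by blast
    moreover have "g c S + g c {e} \<le> g c (insert e S)" if "c \<in> C" "tight S" for c S
    proof -
      have "S = {}" using False that(2) by blast
      then show ?thesis using empty[OF that(1)] by simp
    qed
    ultimately show ?thesis by blast
  qed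
  then obtain e where e: "e \<in> U"
    and step: "\<And>c S. c \<in> C \<Longrightarrow> tight S \<Longrightarrow> e \<notin> S \<Longrightarrow> g c S + g c {e} \<le> g c (insert e S)"
    by blast
  have "int (card S) + 1 \<le> (\<Sum>d\<in>C. if d = c then g d (insert e S) else g d S)"
    if c: "c \<in> C" "1 \<le> g c {e}" and S: "S \<subseteq> U - {e}" for c S
  proof -
    have eq: "(\<Sum>d\<in>C. if d = c then g d (insert e S) else g d S)
        = (\<Sum>d\<in>C. g d S) + (g c (insert e S) - g c S)"
      using C c(1) by (simp add: sum.remove[of C c])
    have S': "S \<subseteq> U" "e \<notin> S" using S by auto
    show ?thesis
    proof (cases "tight S")
      case True
      then show ?thesis using step[OF c(1) True S'(2)] c(2) unfolding eq tight_def by simp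
    next
      case False
      then have "int (card S) < (\<Sum>d\<in>C. g d S)" using hall[OF S'(1)] S'(1) by (simp add: tight_def)
      moreover have "g c S \<le> g c (insert e S)" using e S' by (intro mono c) auto
      ultimately show ?thesis unfolding eq by simp
    qed
  qed
  then show ?thesis using e by blast
qed

section \<open>Rank function of a matroid\<close>

context matroid
begin

definition rank :: "'a set \<Rightarrow> nat" where
  "rank X = Max (card ` {I. indep I \<and> I \<subseteq> X})"

lemma finite_indep_subsets: "finite {I. indep I \<and> I \<subseteq> X}"
  using finite_ground by (rule finite_subset[rotated, OF finite_Pow_iff[THEN iffD2]])
    (auto dest: indep_subset_ground)

lemma card_indep_le_rank: "indep I \<Longrightarrow> I \<subseteq> X \<Longrightarrow> card I \<le> rank X"
  unfolding rank_def by (rule Max_ge) (auto intro: finite_indep_subsets)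

lemma ex_basis:
  obtains I where "indep I" "I \<subseteq> X" "card I = rank X"
proof -
  have "rank X \<in> card ` {I. indep I \<and> I \<subseteq> X}"
    unfolding rank_def by (rule Max_in) (use finite_indep_subsets indep_empty in auto)
  then show ?thesis using that by auto
qed

lemma indep_finite: "indep I \<Longrightarrow> finite I"
  using finite_ground indep_subset_ground finite_subset by blast

lemma rank_mono: "A \<subseteq> B \<Longrightarrow> rank A \<le> rank B"
  by (metis ex_basis card_indep_le_rank subset_trans)

lemma rank_indep: "indep I \<Longrightarrow> rank I = card I"
  by (metis ex_basis card_indep_le_rank card_mono indep_finite order_antisym order_refl)

lemma indep_if_card_le_rank: "finite X \<Longrightarrow> card X \<le> rank X \<Longrightarrow> indep X"
  by (metis ex_basis card_seteq)

text \<open>Augment \<open>I\<close> repeatedly from a maximum independent subset of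
  \<open>X\<close>; each step lowers the deficit \<open>rank X - card I\<close>.\<close>

lemma ex_basis_extending:
  assumes "indep I" "I \<subseteq> X"
  obtains J where "indep J" "I \<subseteq> J" "J \<subseteq> X" "card J = rank X"
proof -
  have "\<exists>J. indep J \<and> I \<subseteq> J \<and> J \<subseteq> X \<and> card J = rank X"
    using assms
  proof (induction "rank X - card I" arbitrary: I rule: less_induct)
    case less
    obtain B where B: "indep B" "B \<subseteq> X" "card B = rank X" by (rule ex_basis)
    show ?case
    proof (cases "card I < rank X")
      case True
      then obtain e where e: "e \<in> B - I" "indep (insert e I)"
        using augmentation[OF less.prems(1) B(1)] B(3) by auto
      have "card (insert e I) = Suc (card I)" using e indep_finite[OF less.prems(1)] by simp
      then have "\<exists>J. indep J \<and> insert e I \<subseteq> J \<and> J \<subseteq> X \<and> card J = rank X"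
        using True e B(2) less.prems by (intro less.hyps) auto
      then show ?thesis by blast
    next
      case False
      then show ?thesis using less.prems card_indep_le_rank[OF less.prems] by (intro exI[of _ I]) auto
    qed
  qed
  then show ?thesis using that by blast
qed

text \<open>Extend a basis \<open>I\<close> of \<open>A \<inter> B\<close> to a basis
  \<open>J\<close> of \<open>A \<union> B\<close>. Its traces on \<open>A\<close> and
  \<open>B\<close> are independent, cover \<open>J\<close>, and overlap in at least
  \<open>I\<close>.\<close>

lemma rank_submodular: "rank (A \<union> B) + rank (A \<inter> B) \<le> rank A + rank B"
proof -
  obtain I where I: "indep I" "I \<subseteq> A \<inter> B" "card I = rank (A \<inter> B)" by (rule ex_basis)
  then have "I \<subseteq> A \<union> B" by blast
  then obtain J where J: "indep J" "I \<subseteq> J" "J \<subseteq> A \<union> B" "card J = rank (A \<union> B)"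
    using ex_basis_extending[OF I(1)] by blast
  have fin: "finite (J \<inter> A)" "finite (J \<inter> B)" using indep_finite[OF J(1)] by auto
  have "card (J \<inter> A) \<le> rank A" "card (J \<inter> B) \<le> rank B"
    using J(1) by (auto intro!: card_indep_le_rank intro: indep_mono)
  moreover have "card (J \<inter> A) + card (J \<inter> B) = card J + card (J \<inter> A \<inter> B)"
  proof -
    have "J \<inter> A \<union> J \<inter> B = J" "J \<inter> A \<inter> (J \<inter> B) = J \<inter> A \<inter> B" using J(3) by auto
    then show ?thesis using card_Un_Int[OF fin] by simp
  qed
  moreover have "card I \<le> card (J \<inter> A \<inter> B)"
    using I(2) J(2) fin by (intro card_mono) auto
  ultimately show ?thesis using I(3) J(4) by linarith
qed

section \<open>Residual ranks and the Hall-type condition\<close>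

definition color_class :: "('a \<rightharpoonup> 'c) \<Rightarrow> 'c \<Rightarrow> 'a set" where
  "color_class f c = {e. f e = Some c}"

text \<open>The rank of \<open>S\<close> in the contraction of the matroid by the color class of \<open>c\<close>.\<close>

definition residual_rank :: "('a \<rightharpoonup> 'c) \<Rightarrow> 'c \<Rightarrow> 'a set \<Rightarrow> int" where
  "residual_rank f c S = int (rank (S \<union> color_class f c)) - int (card (color_class f c))"

text \<open>For finite \<open>C\<close> and a proper \<open>f\<close> with colors in
  \<open>C\<close>, this is the criterion of Edmonds' matroid partition theorem, applied to the
  contractions by the color classes, for \<open>f\<close> to extend to a proper coloring of
  \<open>E\<close> from \<open>C\<close>.\<close>

definition hall_condition :: "'c set \<Rightarrow> ('a \<rightharpoonup> 'c) \<Rightarrow> bool" where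
  "hall_condition C f \<longleftrightarrow>
    (\<forall>S \<subseteq> E - dom f. int (card S) \<le> (\<Sum>c\<in>C. residual_rank f c S))"

lemma proper_color_class: "proper indep f \<Longrightarrow> indep (color_class f c)"
  by (simp add: proper_def color_class_def)

lemma color_class_upd:
  "e \<notin> dom f \<Longrightarrow>
    color_class (f(e \<mapsto> c)) d = (if d = c then insert e (color_class f d) else color_class f d)"
  by (auto simp: color_class_def)

lemma residual_rank_upd:
  assumes "proper indep f" "e \<notin> dom f"
  shows "residual_rank (f(e \<mapsto> c)) d S =
    (if d = c then residual_rank f d (insert e S) - 1 else residual_rank f d S)"
proof -
  have "finite (color_class f d)" using assms(1) by (intro indep_finite proper_color_class)
  moreover have "e \<notin> color_class f d" using assms(2) by (auto simp: color_class_def)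
  ultimately show ?thesis
    unfolding residual_rank_def color_class_upd[OF assms(2)] by (cases "d = c") simp_all
qed

lemma residual_rank_submodular:
  "residual_rank f c (A \<union> B) + residual_rank f c (A \<inter> B)
    \<le> residual_rank f c A + residual_rank f c B"
proof -
  let ?F = "color_class f c"
  have "(A \<union> ?F) \<union> (B \<union> ?F) = A \<union> B \<union> ?F" "(A \<union> ?F) \<inter> (B \<union> ?F) = A \<inter> B \<union> ?F" by auto
  then show ?thesis using rank_submodular[of "A \<union> ?F" "B \<union> ?F"] by (simp add: residual_rank_def)
qed

text \<open>Only the class of \<open>c\<close> changes, and it stays independent iff its rank keeps
  up with its cardinality, which grows by one.\<close>

lemma proper_upd_iff:
  assumes "proper indep f" "e \<notin> dom f"
  shows "proper indep (f(e \<mapsto> c)) \<longleftrightarrow> 1 \<le> residual_rank f c {e}"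
proof -
  let ?F = "color_class f c"
  have F: "finite ?F" "e \<notin> ?F"
    using indep_finite[OF proper_color_class[OF assms(1)]] assms(2)
    by (auto simp: color_class_def)
  have "proper indep (f(e \<mapsto> c)) \<longleftrightarrow> indep (insert e ?F)"
    unfolding proper_def color_class_def[symmetric] color_class_upd[OF assms(2)]
    using proper_color_class[OF assms(1)] by auto
  also have "\<dots> \<longleftrightarrow> card (insert e ?F) \<le> rank (insert e ?F)"
    using F(1) rank_indep[of "insert e ?F"] indep_if_card_le_rank[of "insert e ?F"] by auto
  also have "\<dots> \<longleftrightarrow> 1 \<le> residual_rank f c {e}"
    using F by (auto simp: residual_rank_def)
  finally show ?thesis .
qed

lemma hall_condition_ex_move:
  assumes "hall_condition C f" "proper indep f" "e \<in> E - dom f"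
  shows "\<exists>c\<in>C. proper indep (f(e \<mapsto> c))"
proof (rule ccontr)
  assume "\<not> ?thesis"
  then have "residual_rank f c {e} \<le> 0" if "c \<in> C" for c
    using proper_upd_iff[OF assms(2), of e c] assms(3) that by force
  then have "(\<Sum>c\<in>C. residual_rank f c {e}) \<le> 0" by (rule sum_nonpos)
  moreover have "int (card {e}) \<le> (\<Sum>c\<in>C. residual_rank f c {e})"
    using assms(1,3) unfolding hall_condition_def by blast
  ultimately show False by simp
qed

lemma hall_condition_ex_safe_element:
  assumes C: "finite C" and hall: "hall_condition C f" and proper: "proper indep f"
    and uncolored: "E - dom f \<noteq> {}"
  shows "\<exists>e\<in>E - dom f. \<forall>c\<in>C. proper indep (f(e \<mapsto> c)) \<longrightarrow> hall_condition C (f(e \<mapsto> c))"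
proof -
  have "\<exists>e\<in>E - dom f. \<forall>c\<in>C. 1 \<le> residual_rank f c {e} \<longrightarrow>
    (\<forall>S. S \<subseteq> E - dom f - {e} \<longrightarrow> int (card S) + 1 \<le>
      (\<Sum>d\<in>C. if d = c then residual_rank f d (insert e S) else residual_rank f d S))"
    (is "\<exists>e\<in>_. ?safe e")
  proof (rule submodular_family_ex_safe_element)
    show "residual_rank f c {} = 0" for c
      using rank_indep[OF proper_color_class[OF proper]] by (simp add: residual_rank_def)
    show "residual_rank f c A \<le> residual_rank f c B" if "A \<subseteq> B" for c A B
      using rank_mono[OF Un_mono[OF that order_refl]] by (simp add: residual_rank_def)
    show "int (card S) \<le> (\<Sum>c\<in>C. residual_rank f c S)" if "S \<subseteq> E - dom f" for S
      using hall that unfolding hall_condition_def by blast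
  qed (rule finite_Diff[OF finite_ground] uncolored C residual_rank_submodular)+
  then obtain e where e: "e \<in> E - dom f" and safe: "?safe e" by (rule bexE)
  have "hall_condition C (f(e \<mapsto> c))" if c: "c \<in> C" "proper indep (f(e \<mapsto> c))" for c
    unfolding hall_condition_def
  proof (intro allI impI)
    fix S assume "S \<subseteq> E - dom (f(e \<mapsto> c))"
    then have "S \<subseteq> E - dom f - {e}" by auto
    moreover have "1 \<le> residual_rank f c {e}" using proper_upd_iff[OF proper] e c(2) by blast
    ultimately have "int (card S) + 1 \<le>
        (\<Sum>d\<in>C. if d = c then residual_rank f d (insert e S) else residual_rank f d S)"
      using safe[rule_format, OF c(1)] by blast
    \<comment> \<open>By \<open>residual_rank_upd\<close>, the new residual rank of color
      \<open>c\<close> is one below the old one of \<open>insert e S\<close>; the other colors are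
      unchanged.\<close>
    also have "\<dots> = (\<Sum>d\<in>C. residual_rank (f(e \<mapsto> c)) d S + (if d = c then 1 else 0))"
      using e by (intro sum.cong) (auto simp: residual_rank_upd[OF proper])
    also have "\<dots> = (\<Sum>d\<in>C. residual_rank (f(e \<mapsto> c)) d S) + 1"
      using C c(1) by (simp add: sum.distrib)
    finally show "int (card S) \<le> (\<Sum>d\<in>C. residual_rank (f(e \<mapsto> c)) d S)" by simp
  qed
  then show ?thesis using e by blast
qed

text \<open>A proper coloring cuts \<open>S\<close> into independent pieces, one per color and each
  of size at most \<open>rank S\<close>; with nothing colored, \<open>rank S\<close> is the residual
  rank.\<close>

lemma hall_condition_empty:
  assumes C: "finite C" and colorable: "properly_colorable E indep C"
  shows "hall_condition C Map.empty"
  unfolding hall_condition_def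
proof (intro allI impI)
  fix S assume "S \<subseteq> E - dom (Map.empty :: 'a \<rightharpoonup> 'b)"
  then have S: "S \<subseteq> E" by simp
  obtain f where f: "dom f = E" "ran f \<subseteq> C" "proper indep f"
    using colorable unfolding properly_colorable_def by blast
  have "S = (\<Union>c\<in>C. S \<inter> color_class f c)"
    using S f(1,2) by (fastforce simp: color_class_def ran_def dom_def)
  then have "card S \<le> (\<Sum>c\<in>C. card (S \<inter> color_class f c))"
    using card_UN_le[OF C, of "\<lambda>c. S \<inter> color_class f c"] by simp
  also have "\<dots> \<le> (\<Sum>c\<in>C. rank S)"
    by (intro sum_mono card_indep_le_rank)
      (auto intro: indep_mono[OF proper_color_class[OF f(3)]])
  finally have "int (card S) \<le> (\<Sum>c\<in>C. int (rank S))"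
    unfolding of_nat_sum[symmetric] of_nat_le_iff .
  then show "int (card S) \<le> (\<Sum>c\<in>C. residual_rank Map.empty c S)"
    by (simp add: residual_rank_def color_class_def)
qed

section \<open>Winning strategies and proper colorings\<close>

lemma properly_colorable_imp_winning_strategy:
  fixes C :: "'c set"
  assumes C: "finite C" and colorable: "properly_colorable E indep C"
  shows "\<exists>s. winning_strategy E indep C s"
proof -
  define safe where "safe f e \<longleftrightarrow> e \<in> E - dom f \<and>
    (\<forall>c\<in>C. proper indep (f(e \<mapsto> c)) \<longrightarrow> hall_condition C (f(e \<mapsto> c)))" for f e
  \<comment> \<open>The choice is arbitrary where no safe element exists; the invariant
    \<open>inv\<close> excludes this while elements remain uncolored.\<close>
  define s :: "('a \<times> 'c) list \<Rightarrow> 'a" where "s h = (SOME e. safe (map_of h) e)" for h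
  have safe: "safe (map_of h) (s h)"
    if "hall_condition C (map_of h)" "proper indep (map_of h)" "E - dom (map_of h) \<noteq> {}" for h
    unfolding s_def
    by (rule someI_ex) (use hall_condition_ex_safe_element[OF C that] in \<open>auto simp: safe_def\<close>)
  have inv: "dom (map_of h) \<subseteq> E \<and> proper indep (map_of h) \<and> hall_condition C (map_of h)"
    if "h \<in> plays E indep C s" for h
    using that
  proof induction
    case start
    then show ?case
      using hall_condition_empty[OF C colorable] by (simp add: proper_def indep_empty)
  next
    case (round h c)
    have "safe (map_of h) (s h)" using round by (intro safe) auto
    then have "hall_condition C ((map_of h)(s h \<mapsto> c))" using round by (simp add: safe_def)
    moreover have "map_of ((s h, c) # h) = (map_of h)(s h \<mapsto> c)" by (simp add: fun_eq_iff)
    moreover have "dom ((map_of h)(s h \<mapsto> c)) \<subseteq> E" using round by simp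
    ultimately show ?case using round(4) by (simp only: simp_thms)
  qed
  have "s h \<in> E - dom (map_of h) \<and> (\<exists>c\<in>C. proper indep ((map_of h)(s h \<mapsto> c)))"
    if h: "h \<in> plays E indep C s" and ne: "dom (map_of h) \<noteq> E" for h
  proof -
    have "safe (map_of h) (s h)" using inv[OF h] ne by (intro safe) auto
    then have "s h \<in> E - dom (map_of h)" by (simp add: safe_def)
    then show ?thesis using hall_condition_ex_move inv[OF h] by blast
  qed
  then show ?thesis unfolding winning_strategy_def by blast
qed

text \<open>Every play has at most \<open>card E\<close> rounds, so one of maximal length colors all of \<open>E\<close>.\<close>

lemma winning_strategy_imp_properly_colorable:
  assumes win: "winning_strategy E indep C s"
  shows "properly_colorable E indep C"
proof -
  have inv: "dom (map_of h) \<subseteq> E \<and> proper indep (map_of h) \<and> ran (map_of h) \<subseteq> C \<and>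
      length h = card (dom (map_of h))"
    if "h \<in> plays E indep C s" for h
    using that
  proof induction
    case start
    then show ?case by (simp add: proper_def indep_empty)
  next
    case (round h c)
    have "map_of ((s h, c) # h) = (map_of h)(s h \<mapsto> c)" by (simp add: fun_eq_iff)
    moreover have "dom ((map_of h)(s h \<mapsto> c)) \<subseteq> E" using round by simp
    moreover have "ran ((map_of h)(s h \<mapsto> c)) \<subseteq> C" using round by (auto simp: ran_def)
    moreover have "length ((s h, c) # h) = card (dom ((map_of h)(s h \<mapsto> c)))"
      using round by (simp add: finite_dom_map_of)
    ultimately show ?case using round(4) by (simp only: simp_thms)
  qed
  have "length h < Suc (card E)" if "h \<in> plays E indep C s" for h
    using inv[OF that] card_mono[OF finite_ground, of "dom (map_of h)"] by simp
  then obtain h where h: "h \<in> plays E indep C s"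
    and longest: "\<And>h'. h' \<in> plays E indep C s \<Longrightarrow> length h' \<le> length h"
    using ex_has_greatest_nat[of "\<lambda>h. h \<in> plays E indep C s", OF plays.start,
      of length "Suc (card E)"] by blast
  have "dom (map_of h) = E"
  proof (rule ccontr)
    assume "dom (map_of h) \<noteq> E"
    then obtain c where "s h \<in> E - dom (map_of h)" "c \<in> C" "proper indep ((map_of h)(s h \<mapsto> c))"
      using win h unfolding winning_strategy_def by blast
    then have "(s h, c) # h \<in> plays E indep C s" by (rule plays.round[OF h])
    then show False using longest by fastforce
  qed
  then show ?thesis using inv[OF h] unfolding properly_colorable_def by blast
qed

end

theorem theorem1:
  fixes E :: "'a set" and indep :: "'a set \<Rightarrow> bool"
  assumes "loopless_matroid E indep"
  shows "indicated_chromatic_number E indep = chromatic_number E indep"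
proof -
  interpret loopless_matroid E indep by (rule assms)
  have "(\<exists>s. winning_strategy E indep C s) \<longleftrightarrow> properly_colorable E indep C"
    if "finite C" for C :: "nat set"
    using properly_colorable_imp_winning_strategy[OF that]
      winning_strategy_imp_properly_colorable by blast
  \<comment> \<open>Both minima range over the same finite color sets; \<open>conj_cong\<close>
    makes finiteness available for rewriting under the quantifier.\<close>
  then show ?thesis
    unfolding indicated_chromatic_number_def chromatic_number_def by (simp cong: conj_cong)
qed

end
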